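(* Let $G$ be a finite non-cyclic group of order $n$. Let $M_1,M_2,\ldots,M_r$ be the (distinct) maximal cyclic subgroups of $G$, indexed so that $m_1\geq m_2\geq\cdots\geq m_r$, where $m_i=\phi(|M_i|)$ for $1\leq i\leq r$. Let $\mathcal{G}_{\mathcal{M}(G)}=\{x\in G:\langle x\rangle\in\mathcal{M}(G)\}$, where $\mathcal{M}(G)=\{M_1,\ldots,M_r\}$. Then $$\lambda(\mathcal{P}_E(G))\leq\begin{cases}2n-|\mathcal{G}_{\mathcal{M}(G)}|-1, & \text{if } m_1\leq\sum_{i=2}^r m_i,\\ 2(n-m_1-1), & \text{otherwise.}\end{cases}$$
   Context: The enhanced power graph $\mathcal{P}_E(G)$ of a finite group $G$ is the simple undirected graph with vertex set $G$ in which two distinct vertices $x,y$ are adjacent if there is $z\in G$ with $x,y\in\langle z\rangle$. A maximal cyclic subgroup of $G$ is a cyclic subgroup not properly contained in any other cyclic subgroup of $G$; $\mathcal{M}(G)$ is the set of all maximal cyclic subgroups. $\phi$ is Euler's totient function. An $L(2,1)$-labeling of a finite graph $\Gamma$ is an integer-valued function $f$ on $V(\Gamma)$ such that $|f(u)-f(v)|\geq 2$ whenever $u,v$ are adjacent and $|f(u)-f(v)|\geq 1$ whenever $u,v$ are at distance $2$. Its span is the difference between the maximum and the minimum of $f$. The $\lambda$-number $\lambda(\Gamma)$ is the minimum span over all $L(2,1)$-labelings of $\Gamma$. *)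

theory Defs
  imports
    "HOL-Algebra.Algebra"
    "HOL-Number_Theory.Totient"
    "Graph_Theory.Pair_Digraph"
    "Graph_Theory.Shortest_Path"
begin

text \<open>
  A finite simple undirected graph is a \<^locale>\<open>pair_graph\<close>: finite, loop-free and symmetric,
  each undirected edge being represented by its two arcs.
\<close>

definition enhanced_power_graph :: "('a, 'b) monoid_scheme \<Rightarrow> 'a pair_pre_digraph" where
  "enhanced_power_graph G =
     \<lparr> pverts = carrier G,
       parcs = {(x, y). x \<in> carrier G \<and> y \<in> carrier G \<and> x \<noteq> y \<and>
                  (\<exists>z\<in>carrier G. x \<in> generate G {z} \<and> y \<in> generate G {z})} \<rparr>"

lemma pair_graph_enhanced_power_graph:
  assumes "finite (carrier G)"
  shows "pair_graph (enhanced_power_graph G)"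
proof -
  have "parcs (enhanced_power_graph G) \<subseteq> carrier G \<times> carrier G"
    by (auto simp: enhanced_power_graph_def)
  then have "finite (parcs (enhanced_power_graph G))"
    using assms by (meson finite_SigmaI finite_subset)
  then show ?thesis
    using assms
    by unfold_locales
      (auto simp: enhanced_power_graph_def symmetric_def arcs_ends_def arc_to_ends_def
        with_proj_def intro!: symI)
qed

definition cyclic_subgroup :: "'a set \<Rightarrow> ('a, 'b) monoid_scheme \<Rightarrow> bool" where
  "cyclic_subgroup H G \<longleftrightarrow> subgroup H G \<and> cyclic_group (G\<lparr>carrier := H\<rparr>)"

definition maximal_cyclic_subgroups :: "('a, 'b) monoid_scheme \<Rightarrow> 'a set set" where
  "maximal_cyclic_subgroups G =
     {H. cyclic_subgroup H G \<and> (\<forall>K. cyclic_subgroup K G \<longrightarrow> \<not> H \<subset> K)}"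

definition maximal_cyclic_generators :: "('a, 'b) monoid_scheme \<Rightarrow> 'a set" where
  "maximal_cyclic_generators G =
     {x \<in> carrier G. generate G {x} \<in> maximal_cyclic_subgroups G}"

text \<open>
  The distance is the shortest-path distance \<^const>\<open>wf_digraph.\<mu>\<close> with unit arc weights; it is
  infinite if there is no path.
\<close>

definition graph_dist :: "'a pair_pre_digraph \<Rightarrow> 'a \<Rightarrow> 'a \<Rightarrow> ereal" where
  "graph_dist \<Gamma> u v = wf_digraph.\<mu> (with_proj \<Gamma>) (\<lambda>_. 1) u v"

text \<open>Only the values of a labeling on the vertex set are relevant.\<close>

definition L21_labeling :: "'a pair_pre_digraph \<Rightarrow> ('a \<Rightarrow> int) \<Rightarrow> bool" where
  "L21_labeling \<Gamma> f \<longleftrightarrow>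
     (\<forall>u\<in>pverts \<Gamma>. \<forall>v\<in>pverts \<Gamma>.
        ((u, v) \<in> parcs \<Gamma> \<longrightarrow> \<bar>f u - f v\<bar> \<ge> 2) \<and>
        (graph_dist \<Gamma> u v = 2 \<longrightarrow> \<bar>f u - f v\<bar> \<ge> 1))"

definition L21_span :: "'a pair_pre_digraph \<Rightarrow> ('a \<Rightarrow> int) \<Rightarrow> int" where
  "L21_span \<Gamma> f = Max (f ` pverts \<Gamma>) - Min (f ` pverts \<Gamma>)"

definition lambda_number :: "'a pair_pre_digraph \<Rightarrow> int" where
  "lambda_number \<Gamma> = (LEAST s. \<exists>f. L21_labeling \<Gamma> f \<and> L21_span \<Gamma> f = s)"

text \<open>
  For a nonempty finite simple graph a labeling exists and spans are nonnegative, so the minimum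
  is attained.
\<close>

lemma graph_dist_self:
  assumes "pair_graph \<Gamma>" "u \<in> pverts \<Gamma>"
  shows "graph_dist \<Gamma> u u \<noteq> 2"
proof -
  interpret pair_graph \<Gamma> by fact
  have "awalk u [] u"
    using assms(2) by (simp add: awalk_Nil_iff)
  from min_cost_le_walk_cost[OF this, of "\<lambda>_. 1"]
  have "graph_dist \<Gamma> u u \<le> 0"
    by (simp add: graph_dist_def awalk_cost_Nil zero_ereal_def)
  then show ?thesis
    by auto
qed

lemma L21_labeling_exists:
  assumes "pair_graph \<Gamma>"
  shows "\<exists>f. L21_labeling \<Gamma> f"
proof -
  interpret pair_graph \<Gamma> by fact
  obtain g :: "'a \<Rightarrow> nat" where g: "inj_on g (pverts \<Gamma>)"
    using finite_imp_inj_to_nat_seg[OF pair_finite_verts] by blast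
  have sep: "\<bar>2 * int (g u) - 2 * int (g v)\<bar> \<ge> 2"
    if "u \<in> pverts \<Gamma>" "v \<in> pverts \<Gamma>" "u \<noteq> v" for u v
  proof -
    have "g u \<noteq> g v"
      using g that by (auto dest: inj_onD)
    then show ?thesis
      by linarith
  qed
  have "L21_labeling \<Gamma> (\<lambda>v. 2 * int (g v))"
    unfolding L21_labeling_def
  proof (intro ballI conjI impI)
    fix u v assume uv: "u \<in> pverts \<Gamma>" "v \<in> pverts \<Gamma>"
    { assume "(u, v) \<in> parcs \<Gamma>"
      then have "u \<noteq> v"
        using pair_no_loops by fastforce
      then show "\<bar>2 * int (g u) - 2 * int (g v)\<bar> \<ge> 2"
        using sep uv by blast }
    { assume "graph_dist \<Gamma> u v = 2"
      then have "u \<noteq> v"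
        using graph_dist_self assms uv by metis
      then show "\<bar>2 * int (g u) - 2 * int (g v)\<bar> \<ge> 1"
        using sep[OF uv] by linarith }
  qed
  then show ?thesis
    by blast
qed

lemma lambda_number_is_minimum:
  assumes "pair_graph \<Gamma>" "pverts \<Gamma> \<noteq> {}"
  shows "\<exists>f. L21_labeling \<Gamma> f \<and> L21_span \<Gamma> f = lambda_number \<Gamma>"
    and "L21_labeling \<Gamma> f \<Longrightarrow> lambda_number \<Gamma> \<le> L21_span \<Gamma> f"
proof -
  interpret pair_graph \<Gamma> by fact
  have nonneg: "L21_span \<Gamma> f \<ge> 0" for f
    using assms(2) pair_finite_verts by (simp add: L21_span_def)
  obtain f0 where f0: "L21_labeling \<Gamma> f0"
    using L21_labeling_exists[OF assms(1)] ..
  define k where "k = (LEAST k. \<exists>f. L21_labeling \<Gamma> f \<and> L21_span \<Gamma> f = int k)"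
  have "\<exists>k f. L21_labeling \<Gamma> f \<and> L21_span \<Gamma> f = int k"
    using f0 nonneg[of f0] by (metis nonneg_int_cases)
  then have att: "\<exists>f. L21_labeling \<Gamma> f \<and> L21_span \<Gamma> f = int k"
    unfolding k_def by (rule LeastI_ex)
  have low: "int k \<le> L21_span \<Gamma> f" if "L21_labeling \<Gamma> f" for f
  proof -
    have "L21_span \<Gamma> f = int (nat (L21_span \<Gamma> f))"
      using nonneg[of f] by simp
    then have "k \<le> nat (L21_span \<Gamma> f)"
      unfolding k_def using that by (intro Least_le) blast
    then show ?thesis
      using nonneg[of f] by linarith
  qed
  have eq: "lambda_number \<Gamma> = int k"
    unfolding lambda_number_def using att low by (intro Least_equality) auto
  show "\<exists>f. L21_labeling \<Gamma> f \<and> L21_span \<Gamma> f = lambda_number \<Gamma>"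
    using att eq by simp
  show "L21_labeling \<Gamma> f \<Longrightarrow> lambda_number \<Gamma> \<le> L21_span \<Gamma> f"
    using low eq by simp
qed

end

theory Submission
  imports Defs
begin

text \<open>
  The identity is adjacent to every other element, so all labels must be distinct; conversely an
  injective labeling is an \<open>L(2,1)\<close>-labeling as soon as adjacent vertices never get consecutive
  labels. The two bounds come from two such labelings (\<open>lambda_number_le_alternating\<close> and
  \<open>lambda_number_le_interleaved\<close>). Both exploit that a generator \<open>x\<close> of a maximal cyclic subgroup
  \<open>M\<close> is adjacent only to elements of \<open>M\<close>: if \<open>x\<close> lies in \<open>\<langle>z\<rangle>\<close>, then \<open>\<langle>z\<rangle> = M\<close>.

  In the first case let \<open>A\<close> be the set of all generators of maximal cyclic subgroups, split into
  classes according to the subgroup generated; the class of \<open>M i\<close> has \<open>m i\<close> elements. Elements of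
  different classes are not adjacent. The hypothesis says that no class exceeds half of \<open>A\<close>, so
  \<open>A\<close> can be enumerated with consecutive elements in different classes
  (\<open>alternating_enumeration\<close>). It receives the labels \<open>0, 1, \<dots>, |A| - 1\<close> in this order, and the
  remaining elements receive \<open>|A| + 1, |A| + 3, \<dots>\<close>, up to \<open>2 * n - |A| - 1\<close>.

  In the second case let \<open>C\<close> be the class of \<open>M 1\<close> and \<open>D\<close> the complement of \<open>M 1\<close>. As \<open>G\<close> is not
  cyclic, \<open>M 1\<close> is a proper subgroup, so it has index at least 2 and \<open>|C| < |M 1| \<le> |D|\<close>. The
  elements of \<open>D\<close> get the even labels \<open>0, 2, \<dots>\<close>, those of \<open>C\<close> fit into the odd gaps between
  them, and the rest of \<open>M 1\<close> gets the next even labels. Only \<open>n - m 1\<close> even labels are used, so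
  the largest is \<open>2 * (n - m 1 - 1)\<close>. This bound holds for every maximal cyclic subgroup,
  whatever the sizes of the classes.
\<close>

section \<open>Bounding the labeling number by an injective labeling\<close>

lemma lambda_number_le_of_inj_labeling:
  fixes f :: "'a \<Rightarrow> nat" and b :: int
  assumes \<Gamma>: "pair_graph \<Gamma>" "pverts \<Gamma> \<noteq> {}"
    and inj: "inj_on f (pverts \<Gamma>)"
    and le: "\<And>x. x \<in> pverts \<Gamma> \<Longrightarrow> int (f x) \<le> b"
    and adj: "\<And>u v. (u, v) \<in> parcs \<Gamma> \<Longrightarrow> f v \<noteq> Suc (f u)"
  shows "lambda_number \<Gamma> \<le> b"
proof -
  interpret pair_graph \<Gamma> by fact
  let ?g = "\<lambda>x. int (f x)"
  have "L21_labeling \<Gamma> ?g"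
    unfolding L21_labeling_def
  proof (intro ballI conjI impI)
    fix u v assume uv: "u \<in> pverts \<Gamma>" "v \<in> pverts \<Gamma>"
    have sep: "f u \<noteq> f v" if "u \<noteq> v"
      using inj uv that by (auto dest: inj_onD)
    { assume "(u, v) \<in> parcs \<Gamma>"
      moreover from this have "(v, u) \<in> parcs \<Gamma>"
        by (rule arcs_symmetric)
      ultimately have "f v \<noteq> Suc (f u)" "f u \<noteq> Suc (f v)" "f u \<noteq> f v"
        using adj sep pair_no_loops by fastforce+
      then show "\<bar>?g u - ?g v\<bar> \<ge> 2"
        by linarith }
    { assume "graph_dist \<Gamma> u v = 2"
      then have "f u \<noteq> f v"
        using graph_dist_self[OF \<Gamma>(1) uv(1)] sep by metis
      then show "\<bar>?g u - ?g v\<bar> \<ge> 1"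
        by linarith }
  qed
  then have "lambda_number \<Gamma> \<le> L21_span \<Gamma> ?g"
    by (rule lambda_number_is_minimum(2)[OF \<Gamma>])
  also have "Max (?g ` pverts \<Gamma>) \<le> b" "0 \<le> Min (?g ` pverts \<Gamma>)"
    using le \<Gamma>(2) pair_finite_verts by auto
  then have "L21_span \<Gamma> ?g \<le> b"
    unfolding L21_span_def by linarith
  finally show ?thesis
    by simp
qed

section \<open>Arranging a partitioned set\<close>

text \<open>
  A finite set split into classes, none of which makes up more than half of it (rounded up), can
  be enumerated so that consecutive elements lie in different classes. For the induction the first
  element is also kept out of a prescribed class \<open>q\<close>, that of the element preceding it, which
  must then make up at most half (rounded down). The greedy choice works: put
  first an element of a largest class other than \<open>q\<close>.
\<close>

lemma alternating_enumeration:
  assumes "finite A"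
    and "\<And>k. 2 * card {x \<in> A. c x = k} \<le> card A + 1"
    and "2 * card {x \<in> A. c x = q} \<le> card A"
  shows "\<exists>p. bij_betw p A {0..<card A} \<and>
    (\<forall>x\<in>A. \<forall>y\<in>A. p y = Suc (p x) \<longrightarrow> c x \<noteq> c y) \<and> (\<forall>x\<in>A. p x = 0 \<longrightarrow> c x \<noteq> q)"
  using assms
proof (induction "card A" arbitrary: A q)
  case 0
  then show ?case
    by (simp add: bij_betw_def)
next
  case (Suc N)
  let ?C = "\<lambda>k. {x \<in> A. c x = k}"
  have "A \<noteq> ?C q"
    using Suc.prems(3) Suc.hyps(2) by auto
  then have ne: "c ` A - {q} \<noteq> {}"
    by auto
  have fin: "finite (c ` A - {q})"
    using Suc.prems(1) by simp
  obtain k where k: "k \<in> c ` A - {q}"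
    and kmax: "\<And>j. j \<in> c ` A - {q} \<Longrightarrow> card (?C j) \<le> card (?C k)"
  proof -
    let ?N = "(\<lambda>k. card (?C k)) ` (c ` A - {q})"
    have "Max ?N \<in> ?N"
      using fin ne by (intro Max_in) auto
    then obtain k where "k \<in> c ` A - {q}" "card (?C k) = Max ?N"
      unfolding image_iff by metis
    moreover have "card (?C j) \<le> Max ?N" if "j \<in> c ` A - {q}" for j
      using fin that by (intro Max_ge) auto
    ultimately show ?thesis
      using that by simp
  qed
  then obtain a where a: "a \<in> A" "c a = k" "k \<noteq> q"
    by auto
  define B where "B = A - {a}"
  have B: "finite B" "card B = N" "card A = Suc N"
    using Suc.prems(1) Suc.hyps(2) a(1) by (auto simp: B_def)
  have classk: "card (?C k) = Suc (card {x \<in> B. c x = k})"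
  proof -
    have "?C k = insert a {x \<in> B. c x = k}"
      using a by (auto simp: B_def)
    then show ?thesis
      using B(1) by (simp add: B_def)
  qed
  have other: "{x \<in> B. c x = j} = ?C j" if "j \<noteq> k" for j
    using a that by (auto simp: B_def)
  have bound: "2 * card {x \<in> B. c x = j} \<le> card B + 1" for j
  proof -
    consider "j = k" | "j = q" | "j \<noteq> k" "j \<noteq> q" "j \<in> c ` A" | "j \<notin> c ` A"
      by blast
    then show ?thesis
    proof cases
      case 1
      then show ?thesis
        using classk Suc.prems(2)[of k] B by simp
    next
      case 2
      then show ?thesis
        using other[of q] a(3) Suc.prems(3) B by simp
    next
      case 3
      have "card (?C j) + card (?C k) = card (?C j \<union> ?C k)"
        using Suc.prems(1) 3(1) by (intro card_Un_disjoint[symmetric]) auto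
      also have "\<dots> \<le> card A"
        using Suc.prems(1) by (intro card_mono) auto
      finally show ?thesis
        using kmax[of j] 3 other[of j] B by simp
    next
      case 4
      then have "{x \<in> B. c x = j} = {}"
        by (auto simp: B_def)
      then show ?thesis
        by (simp only: card.empty)
    qed
  qed
  have boundk: "2 * card {x \<in> B. c x = k} \<le> card B"
    using classk Suc.prems(2)[of k] B by simp
  obtain p where p: "bij_betw p B {0..<card B}"
    and pc: "\<And>x y. x \<in> B \<Longrightarrow> y \<in> B \<Longrightarrow> p y = Suc (p x) \<Longrightarrow> c x \<noteq> c y"
    and p0: "\<And>x. x \<in> B \<Longrightarrow> p x = 0 \<Longrightarrow> c x \<noteq> k"
    using Suc.hyps(1)[OF B(2)[symmetric] B(1) bound boundk] by blast
  define p' where "p' x = (if x = a then 0 else Suc (p x))" for x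
  have "bij_betw (\<lambda>x. Suc (p x)) B {Suc 0..<Suc N}"
    using bij_betw_trans[OF p, of Suc "{Suc 0..<Suc N}"] B
    by (simp add: o_def bij_betw_def image_Suc_atLeastLessThan)
  then have "bij_betw p' B {Suc 0..<Suc N}"
    by (rule bij_betw_cong[THEN iffD1, rotated]) (auto simp: B_def p'_def)
  then have "bij_betw p' (B \<union> {a}) ({Suc 0..<Suc N} \<union> {0})"
    by (intro bij_betw_combine) (auto simp: p'_def)
  moreover have "B \<union> {a} = A" "{Suc 0..<Suc N} \<union> {0} = {0..<card A}"
    using a(1) B by (auto simp: B_def)
  ultimately have "bij_betw p' A {0..<card A}"
    by simp
  moreover have "\<forall>x\<in>A. \<forall>y\<in>A. p' y = Suc (p' x) \<longrightarrow> c x \<noteq> c y"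
  proof (intro ballI impI)
    fix x y assume xy: "x \<in> A" "y \<in> A" "p' y = Suc (p' x)"
    then have "y \<in> B" "p' y = Suc (p y)"
      by (auto simp: p'_def B_def split: if_splits)
    then show "c x \<noteq> c y"
      using xy pc[of x y] p0[of y] a(2) by (cases "x = a") (auto simp: p'_def B_def)
  qed
  moreover have "\<forall>x\<in>A. p' x = 0 \<longrightarrow> c x \<noteq> q"
    using a by (auto simp: p'_def)
  ultimately show ?case
    by blast
qed

section \<open>Maximal cyclic subgroups\<close>

context group
begin

lemma generate_singleton_subset_iff:
  assumes "x \<in> carrier G" "z \<in> carrier G"
  shows "generate G {x} \<subseteq> generate G {z} \<longleftrightarrow> x \<in> generate G {z}"
  using assms generate_subgroup_incl[of "{x}" "generate G {z}"] generate_is_subgroup[of "{z}"]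
    generate.incl[of x "{x}" G] by auto

lemma cyclic_subgroup_iff:
  "cyclic_subgroup H G \<longleftrightarrow> (\<exists>x\<in>carrier G. H = generate G {x})"
proof -
  have "cyclic_group (G\<lparr>carrier := H\<rparr>) \<longleftrightarrow> (\<exists>x\<in>H. H = generate G {x})" if H: "subgroup H G"
  proof -
    interpret H: group "G\<lparr>carrier := H\<rparr>"
      using H by (rule subgroup_imp_group)
    have "generate (G\<lparr>carrier := H\<rparr>) {x} = generate G {x}" if "x \<in> H" for x
      using generate_consistent[of "{x}" H] that H by simp
    moreover have "range (\<lambda>n::int. x [^]\<^bsub>G\<lparr>carrier := H\<rparr>\<^esub> n) = generate (G\<lparr>carrier := H\<rparr>) {x}"
      if "x \<in> H" for x
      using H.generate_pow[of x] that by auto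
    ultimately show ?thesis
      by (auto simp: H.cyclic_group)
  qed
  then show ?thesis
    unfolding cyclic_subgroup_def
    using generate_is_subgroup subgroup.mem_carrier generate.incl[of _ "{_}" G]
    by (metis empty_subsetI insert_subset singletonI)
qed

lemma maximal_cyclic_generator_unique:
  assumes "x \<in> maximal_cyclic_generators G" "z \<in> carrier G" "x \<in> generate G {z}"
  shows "generate G {z} = generate G {x}"
proof -
  have "generate G {x} \<subseteq> generate G {z}"
    using assms generate_singleton_subset_iff by (auto simp: maximal_cyclic_generators_def)
  moreover have "\<not> generate G {x} \<subset> generate G {z}"
    using assms cyclic_subgroup_iff
    by (auto simp: maximal_cyclic_generators_def maximal_cyclic_subgroups_def)
  ultimately show ?thesis
    by blast
qed

lemma maximal_cyclic_subgroups_nonempty: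
  assumes "finite (carrier G)"
  shows "maximal_cyclic_subgroups G \<noteq> {}"
proof -
  let ?S = "{H. cyclic_subgroup H G}"
  have "?S \<subseteq> Pow (carrier G)"
    by (auto simp: cyclic_subgroup_def dest: subgroup.subset)
  then have "finite ?S"
    using assms by (meson finite_Pow_iff finite_subset)
  moreover have "?S \<noteq> {}"
    using cyclic_subgroup_iff by blast
  ultimately obtain H where "H \<in> ?S" "\<And>K. K \<in> ?S \<Longrightarrow> H \<subseteq> K \<Longrightarrow> H = K"
    using finite_has_maximal[of ?S] by metis
  then have "H \<in> maximal_cyclic_subgroups G"
    by (auto simp: maximal_cyclic_subgroups_def)
  then show ?thesis
    by blast
qed

lemma card_generators_cyclic:
  assumes fin: "finite (carrier G)" and x: "x \<in> carrier G"
  shows "card {y \<in> carrier G. generate G {y} = generate G {x}} = totient (card (generate G {x}))"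
proof -
  let ?S = "{y \<in> carrier G. generate G {y} = generate G {x}}"
  have ord1: "ord x \<ge> 1"
    using fin x by (rule ord_ge_1)
  have sub: "generate G {x} \<subseteq> carrier G"
    using x by (intro generate_incl) auto
  have mem: "x [^] k \<in> ?S \<longleftrightarrow> coprime k (ord x)" if "k > 0" for k :: nat
  proof -
    have "x [^] k \<in> generate G {x}"
      using generate_pow_on_finite_carrier[OF fin x] by blast
    then have "generate G {x [^] k} \<subseteq> generate G {x}"
      using x generate_singleton_subset_iff by simp
    then have "generate G {x [^] k} = generate G {x} \<longleftrightarrow> ord (x [^] k) = ord x"
      using x generate_pow_card finite_subset[OF sub fin]
      by (metis card_subset_eq nat_pow_closed)
    also have "\<dots> \<longleftrightarrow> ord x div gcd (ord x) k = ord x"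
      using ord_pow_gen[OF x, of k] that by simp
    also have "\<dots> \<longleftrightarrow> coprime k (ord x)"
      using ord1 by (auto simp: coprime_iff_gcd_eq_1 gcd.commute div_eq_dividend_iff)
    finally show ?thesis
      using x by simp
  qed
  have "?S \<subseteq> (\<lambda>k. x [^] k) ` totatives (ord x)"
  proof
    fix y assume y: "y \<in> ?S"
    then have "y \<in> generate G {x}"
      using generate.incl[of y "{y}" G] by auto
    then obtain j where j: "j \<in> {0..ord x - 1}" "y = x [^] j"
      using generate_pow_on_finite_carrier[OF fin x] ord_elems[OF fin x] by auto
    \<comment> \<open>The totatives of 1 are \<open>{1}\<close>, so exponents are taken in the range from 1 to the order.\<close>
    define k where "k = (if j = 0 then ord x else j)"
    have "y = x [^] k" "0 < k" "k \<le> ord x"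
      using j ord1 x by (auto simp: k_def)
    then show "y \<in> (\<lambda>k. x [^] k) ` totatives (ord x)"
      using mem[of k] y by (auto simp: in_totatives_iff)
  qed
  moreover have "(\<lambda>k. x [^] k) ` totatives (ord x) \<subseteq> ?S"
  proof
    fix y assume "y \<in> (\<lambda>k. x [^] k) ` totatives (ord x)"
    then obtain k where "k \<in> totatives (ord x)" "y = x [^] k"
      by (rule imageE)
    then show "y \<in> ?S"
      using mem[of k] by (simp only: in_totatives_iff)
  qed
  ultimately have "?S = (\<lambda>k. x [^] k) ` totatives (ord x)"
    by (rule subset_antisym)
  moreover have "inj_on (\<lambda>k. x [^] k) (totatives (ord x))"
    using ord_inj'[OF x] by (rule inj_on_subset) (auto simp: in_totatives_iff)
  ultimately have "card ?S = totient (ord x)"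
    by (simp only: card_image totient_def)
  then show ?thesis
    by (simp only: generate_pow_card[OF x])
qed

lemma card_generators_maximal_cyclic:
  assumes "finite (carrier G)" "H \<in> maximal_cyclic_subgroups G"
  shows "card {y \<in> maximal_cyclic_generators G. generate G {y} = H} = totient (card H)"
proof -
  obtain x where "x \<in> carrier G" "H = generate G {x}"
    using assms(2) cyclic_subgroup_iff by (auto simp: maximal_cyclic_subgroups_def)
  moreover have "{y \<in> maximal_cyclic_generators G. generate G {y} = H} =
      {y \<in> carrier G. generate G {y} = H}"
    using assms(2) by (auto simp: maximal_cyclic_generators_def)
  ultimately show ?thesis
    using card_generators_cyclic[OF assms(1)] by simp
qed

lemma proper_subgroup_card_le_half:
  assumes "finite (carrier G)" "subgroup H G" "H \<noteq> carrier G"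
  shows "2 * card H \<le> order G"
proof -
  have eq: "card (rcosets H) * card H = order G"
    using lagrange[OF assms(2)] .
  have "card H \<noteq> order G"
    using assms card_subset_eq[of "carrier G" H] subgroup.subset unfolding order_def by blast
  moreover have "order G \<noteq> 0"
    using assms(1) order_gt_0_iff_finite by simp
  ultimately have "card (rcosets H) \<noteq> 0" "card (rcosets H) \<noteq> 1"
    using eq by (metis mult_zero_left, metis mult_1)
  then have "2 \<le> card (rcosets H)"
    by linarith
  then show ?thesis
    using eq mult_le_mono1 by metis
qed

lemma cyclic_subgroup_proper:
  assumes "\<not> cyclic_group G" "cyclic_subgroup H G"
  shows "H \<noteq> carrier G"
  using assms by (auto simp: cyclic_subgroup_def)

section \<open>Two labelings of the enhanced power graph\<close>

text \<open>
  The alternating labeling, available if the generators of no maximal cyclic subgroup make up more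
  than half (rounded up) of the generators of all of them.
\<close>

lemma lambda_number_le_alternating:
  assumes fin: "finite (carrier G)"
    and half: "\<And>H. H \<in> maximal_cyclic_subgroups G \<Longrightarrow>
      2 * totient (card H) \<le> card (maximal_cyclic_generators G) + 1"
  shows "lambda_number (enhanced_power_graph G) \<le>
    2 * int (order G) - int (card (maximal_cyclic_generators G)) - 1"
proof -
  let ?P = "enhanced_power_graph G"
  define A where "A = maximal_cyclic_generators G"
  define a where "a = card A"
  have AG: "A \<subseteq> carrier G" and finA: "finite A"
    using fin by (auto simp: A_def maximal_cyclic_generators_def)
  have a_le: "a \<le> order G"
    unfolding a_def order_def using AG fin by (rule card_mono[rotated])
  have bound: "2 * card {x \<in> A. generate G {x} = K} \<le> card A + 1" for K
  proof (cases "K \<in> maximal_cyclic_subgroups G")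
    case True
    then show ?thesis
      using half card_generators_maximal_cyclic[OF fin] by (simp add: A_def)
  next
    case False
    then have "{x \<in> A. generate G {x} = K} = {}"
      by (auto simp: A_def maximal_cyclic_generators_def)
    then show ?thesis
      by (simp only: card.empty)
  qed
  \<comment> \<open>The empty set is not a subgroup, so as \<open>q\<close> it puts no constraint on the first element.\<close>
  have "{x \<in> A. generate G {x} = {}} = {}"
    using generate.one[of G] by blast
  then have bound0: "2 * card {x \<in> A. generate G {x} = {}} \<le> card A"
    by (simp only: card.empty)
  obtain p where p: "bij_betw p A {0..<a}"
    and pc: "\<And>x y. x \<in> A \<Longrightarrow> y \<in> A \<Longrightarrow> p y = Suc (p x) \<Longrightarrow> generate G {x} \<noteq> generate G {y}"
    using alternating_enumeration[OF finA bound bound0] unfolding a_def by blast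
  obtain g where g: "bij_betw g (carrier G - A) {0..<order G - a}"
    using ex_bij_betw_finite_nat[of "carrier G - A"] fin AG finA
    by (auto simp: card_Diff_subset order_def a_def)
  define f where "f x = (if x \<in> A then p x else a + 1 + 2 * g x)" for x
  have p_less: "p x < a" if "x \<in> A" for x
    using p that by (auto simp: bij_betw_def)
  have g_less: "g x < order G - a" if "x \<in> carrier G" "x \<notin> A" for x
    using g that by (auto simp: bij_betw_def)
  show ?thesis
    unfolding A_def[symmetric] a_def[symmetric]
  proof (rule lambda_number_le_of_inj_labeling)
    show "pair_graph ?P"
      using fin by (rule pair_graph_enhanced_power_graph)
    show "pverts ?P \<noteq> {}"
      by (auto simp: enhanced_power_graph_def)
    show "inj_on f (pverts ?P)"
    proof (rule inj_onI)
      fix x y assume "x \<in> pverts ?P" "y \<in> pverts ?P" "f x = f y"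
      then show "x = y"
        using p_less[of x] p_less[of y] inj_onD[OF bij_betw_imp_inj_on[OF p], of x y]
          inj_onD[OF bij_betw_imp_inj_on[OF g], of x y]
        by (auto simp: f_def enhanced_power_graph_def split: if_splits)
    qed
    show "int (f x) \<le> 2 * int (order G) - int a - 1" if "x \<in> pverts ?P" for x
      using that p_less[of x] g_less[of x] a_le by (auto simp: f_def enhanced_power_graph_def)
    show "f v \<noteq> Suc (f u)" if "(u, v) \<in> parcs ?P" for u v
    proof
      assume eq: "f v = Suc (f u)"
      obtain z where uv: "u \<in> carrier G" "v \<in> carrier G" "u \<noteq> v"
        and z: "z \<in> carrier G" "u \<in> generate G {z}" "v \<in> generate G {z}"
        using \<open>(u, v) \<in> parcs ?P\<close> by (auto simp: enhanced_power_graph_def)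
      have "u \<in> A \<and> v \<in> A"
        using eq uv p_less[of u] p_less[of v] by (auto simp: f_def split: if_splits) presburger
      moreover from this have "generate G {u} = generate G {v}"
        using maximal_cyclic_generator_unique z unfolding A_def by metis
      ultimately show False
        using pc[of u v] eq by (simp add: f_def)
    qed
  qed
qed

text \<open>
  The labeling that interleaves the generators of one maximal cyclic subgroup with the complement
  of this subgroup.
\<close>

lemma lambda_number_le_interleaved:
  assumes fin: "finite (carrier G)"
    and nc: "\<not> cyclic_group G"
    and H: "H \<in> maximal_cyclic_subgroups G"
  shows "lambda_number (enhanced_power_graph G) \<le>
    2 * (int (order G) - int (totient (card H)) - 1)"
proof -
  let ?P = "enhanced_power_graph G"
  define C where "C = {x \<in> maximal_cyclic_generators G. generate G {x} = H}"
  define t where "t = totient (card H)"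
  define D where "D = carrier G - H"
  define d where "d = card D"
  have cyc: "cyclic_subgroup H G" and sub: "subgroup H G"
    using H by (auto simp: maximal_cyclic_subgroups_def cyclic_subgroup_def)
  have HG: "H \<subseteq> carrier G" and finH: "finite H"
    using subgroup.subset[OF sub] fin finite_subset by blast+
  have proper: "H \<noteq> carrier G"
    using cyclic_subgroup_proper[OF nc cyc] .
  have two: "2 * card H \<le> order G"
    using proper_subgroup_card_le_half[OF fin sub proper] .
  have d: "d = order G - card H"
    using HG finH by (simp add: d_def D_def order_def card_Diff_subset)
  have CH: "C \<subseteq> H"
    unfolding C_def using generate.incl[of _ "{_}" G] by blast
  have cardC: "card C = t"
    using card_generators_maximal_cyclic[OF fin H] by (simp add: C_def t_def)
  have "H \<noteq> {\<one>}"
  proof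
    assume triv: "H = {\<one>}"
    have "x = \<one>" if "x \<in> carrier G" for x
    proof -
      have "\<one> \<in> generate G {x}" "cyclic_subgroup (generate G {x}) G"
        using cyclic_subgroup_iff that generate.one by blast+
      then have "generate G {x} = H"
        using H triv unfolding maximal_cyclic_subgroups_def by blast
      then show ?thesis
        using triv generate.incl[of x "{x}" G] by auto
    qed
    then show False
      using proper triv by auto
  qed
  then have "\<one> \<notin> C"
    using generate_one by (auto simp: C_def)
  then have "C \<subset> H"
    using CH subgroup.one_closed[OF sub] by blast
  then have t_less: "t < card H"
    using cardC finH psubset_card_mono by blast
  obtain e where e: "bij_betw e C {0..<t}"
    using ex_bij_betw_finite_nat[of C] finite_subset[OF CH finH] cardC by auto
  obtain h where h: "bij_betw h D {0..<d}"
    using ex_bij_betw_finite_nat[of D] fin by (auto simp: D_def d_def)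
  obtain g where g: "bij_betw g (H - C) {0..<card H - t}"
    using ex_bij_betw_finite_nat[of "H - C"] finH finite_subset[OF CH finH] CH cardC
    by (auto simp: card_Diff_subset)
  define f where "f x = (if x \<in> C then 2 * e x + 1 else if x \<in> D then 2 * h x else 2 * (d + g x))"
    for x
  have e_less: "e x < t" if "x \<in> C" for x
    using e that by (auto simp: bij_betw_def)
  have h_less: "h x < d" if "x \<in> D" for x
    using h that by (auto simp: bij_betw_def)
  have g_less: "g x < card H - t" if "x \<in> H" "x \<notin> C" for x
    using g that by (auto simp: bij_betw_def)
  show ?thesis
    unfolding t_def[symmetric]
  proof (rule lambda_number_le_of_inj_labeling)
    show "pair_graph ?P"
      using fin by (rule pair_graph_enhanced_power_graph)
    show "pverts ?P \<noteq> {}"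
      by (auto simp: enhanced_power_graph_def)
    show "inj_on f (pverts ?P)"
    proof (rule inj_onI)
      fix x y assume xy: "x \<in> pverts ?P" "y \<in> pverts ?P" "f x = f y"
      have par: "x \<in> C \<longleftrightarrow> y \<in> C"
        using xy(3) by (auto simp: f_def split: if_splits) presburger+
      show "x = y"
        using xy par h_less[of x] h_less[of y] inj_onD[OF bij_betw_imp_inj_on[OF e], of x y]
          inj_onD[OF bij_betw_imp_inj_on[OF h], of x y]
          inj_onD[OF bij_betw_imp_inj_on[OF g], of x y]
        by (auto simp: f_def D_def enhanced_power_graph_def split: if_splits)
    qed
    show "int (f x) \<le> 2 * (int (order G) - int t - 1)" if "x \<in> pverts ?P" for x
    proof -
      have "f x + 2 + 2 * t \<le> 2 * order G"
        using that e_less[of x] h_less[of x] g_less[of x] two d t_less CH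
        by (auto simp: f_def D_def enhanced_power_graph_def)
      then have "int (f x + 2 + 2 * t) \<le> int (2 * order G)"
        by (simp only: of_nat_le_iff)
      then show ?thesis
        by simp
    qed
    show "f v \<noteq> Suc (f u)" if "(u, v) \<in> parcs ?P" for u v
    proof
      assume eq: "f v = Suc (f u)"
      obtain z where uv: "u \<in> carrier G" "v \<in> carrier G" "u \<noteq> v"
        and z: "z \<in> carrier G" "u \<in> generate G {z}" "v \<in> generate G {z}"
        using \<open>(u, v) \<in> parcs ?P\<close> by (auto simp: enhanced_power_graph_def)
      have nbr: "x \<in> H \<and> y \<in> H" if "x \<in> C" "x \<in> generate G {z}" "y \<in> generate G {z}" for x y
        using that maximal_cyclic_generator_unique[of x z] z(1) by (auto simp: C_def)
      have one: "(u \<in> C) \<noteq> (v \<in> C)"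
        using eq by (auto simp: f_def split: if_splits) presburger+
      then have "u \<notin> D" "v \<notin> D"
        using nbr z by (auto simp: D_def)
      have "t < d"
        using t_less two d by linarith
      \<comment> \<open>Hence the odd labels, all at most \<open>2 * t - 1\<close>, keep a distance of at least 3 from the
        labels from \<open>2 * d\<close> on.\<close>
      then have far: "f x + 3 \<le> f y" if "x \<in> C" "y \<notin> C" "y \<notin> D" for x y
        using that e_less[of x] by (simp add: f_def)
      show False
        using one eq far[of u v] far[of v u] \<open>u \<notin> D\<close> \<open>v \<notin> D\<close> by linarith
    qed
  qed
qed

end

theorem theorem3p2:
  fixes G :: "('a, 'b) monoid_scheme"
    and n r :: nat
    and M :: "nat \<Rightarrow> 'a set"
    and m :: "nat \<Rightarrow> nat"
  assumes "group G"
    and "finite (carrier G)"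
    and "\<not> cyclic_group G"
    and "order G = n"
    and "bij_betw M {1..r} (maximal_cyclic_subgroups G)"
    and "\<And>i. i \<in> {1..r} \<Longrightarrow> m i = totient (card (M i))"
    and "\<And>i j. 1 \<le> i \<Longrightarrow> i \<le> j \<Longrightarrow> j \<le> r \<Longrightarrow> m j \<le> m i"
  shows "lambda_number (enhanced_power_graph G) \<le>
    (if m 1 \<le> (\<Sum>i=2..r. m i)
     then 2 * int n - int (card (maximal_cyclic_generators G)) - 1
     else 2 * (int n - int (m 1) - 1))"
proof -
  interpret group G by fact
  have r: "1 \<le> r"
    using maximal_cyclic_subgroups_nonempty[OF assms(2)] assms(5)
    by (cases r) (auto simp: bij_betw_def)
  have Mi: "M i \<in> maximal_cyclic_subgroups G" if "i \<in> {1..r}" for i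
    using assms(5) that by (auto simp: bij_betw_def)
  show ?thesis
  proof (cases "m 1 \<le> (\<Sum>i=2..r. m i)")
    case True
    let ?A = "maximal_cyclic_generators G"
    have "card ?A =
        (\<Sum>H\<in>maximal_cyclic_subgroups G. card {x \<in> ?A. generate G {x} = H})"
    proof -
      have "finite ?A"
        using assms(2) by (simp add: maximal_cyclic_generators_def)
      moreover have "finite (maximal_cyclic_subgroups G)"
        using bij_betw_finite[OF assms(5)] by simp
      moreover have "(\<lambda>x. generate G {x}) ` ?A \<subseteq> maximal_cyclic_subgroups G"
        by (auto simp: maximal_cyclic_generators_def)
      ultimately show ?thesis
        using sum.group[of ?A "maximal_cyclic_subgroups G" "\<lambda>x. generate G {x}" "\<lambda>_. 1::nat"]
        by simp
    qed
    also have "\<dots> = (\<Sum>H\<in>maximal_cyclic_subgroups G. totient (card H))"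
      using card_generators_maximal_cyclic[OF assms(2)] by (intro sum.cong) auto
    also have "\<dots> = (\<Sum>i=1..r. m i)"
      using assms(6) sum.reindex_bij_betw[OF assms(5), of "\<lambda>H. totient (card H)"] by simp
    also have "\<dots> = m 1 + (\<Sum>i=2..r. m i)"
      using r by (simp add: sum.atLeast_Suc_atMost numeral_2_eq_2)
    finally have card_A: "2 * m 1 \<le> card ?A"
      using True by linarith
    have "2 * totient (card H) \<le> card ?A + 1" if "H \<in> maximal_cyclic_subgroups G" for H
    proof -
      have "H \<in> M ` {1..r}"
        using bij_betw_imp_surj_on[OF assms(5)] that by (simp only:)
      then obtain i where "i \<in> {1..r}" "H = M i"
        by (rule imageE)
      then have "totient (card H) \<le> m 1"
        using assms(6)[of i] assms(7)[of 1 i] by auto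
      then show ?thesis
        using card_A by linarith
    qed
    from lambda_number_le_alternating[OF assms(2) this] show ?thesis
      using True assms(4) by simp
  next
    case False
    then show ?thesis
      using lambda_number_le_interleaved[OF assms(2,3) Mi[of 1]] r assms(4) assms(6)[of 1] by simp
  qed
qed

end
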